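(* Let $k$ be a field with $\operatorname{char} k\neq 3$ containing a primitive third root of unity $\omega$. Let $l=k(\alpha)$ be a cubic field extension of $k$ with $\alpha^3=b\in k^\times$, let $a\in k^\times$, and let $A=(l,a)$ be a cyclic central simple algebra over $k$ of degree $3$. If the binary cubic form $\langle a,b\rangle$ represents $1$ or $b^2$, or the binary cubic form $\langle a,b^2\rangle$ represents $1$ or $b$, then $A\cong \mathrm{Mat}_3(k)$.
   Context: Diagonal cubic forms: for $a_1,a_2\in k$, the binary cubic form $\langle a_1,a_2\rangle$ is the polynomial $a_1x_1^3+a_2x_2^3$ over $k$. A form $\varphi\in k[x_1,\dots,x_m]$ represents $c\in k^\times$ if there are $c_1,\dots,c_m\in k$ with $\varphi(c_1,\dots,c_m)=c$. Cyclic algebras: let $l/k$ be a Galois field extension with Galois group identified with $\mathbb{Z}/n\mathbb{Z}$, and let $\mu$ be the automorphism corresponding to $1+n\mathbb{Z}$ (a chosen generator of the Galois group). For $a\in k^\times$ the cyclic algebra is $(l,a)=l\oplus lz\oplus\dots\oplus lz^{n-1}$ with multiplication determined by $z^n=a$ and $zu=\mu(u)z$ for $u\in l$. It is a central simple $k$-algebra of degree $n$ (here $n=3$). *)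

theory Defs
  imports "Jordan_Normal_Form.Matrix" "HOL-Algebra.Algebra"
begin

section \<open>Forms and the elements they represent\<close>

context ring
begin

text \<open>Polynomials in several variables are those of \<^theory>\<open>HOL-Algebra.Indexed_Polynomials\<close>:
  a polynomial maps each monomial, a multiset of variables, to its coefficient.\<close>

definition indexed_value :: "('c multiset \<Rightarrow> 'a) \<Rightarrow> ('c \<Rightarrow> 'a) \<Rightarrow> 'a"
  where "indexed_value P x =
    (\<Oplus>m\<in>{m. P m \<noteq> \<zero>}. P m \<otimes> (\<Otimes>i\<in>set_mset m. x i [^] count m i))"

definition represents :: "nat \<Rightarrow> (nat multiset \<Rightarrow> 'a) \<Rightarrow> 'a \<Rightarrow> bool"
  where "represents m P c \<longleftrightarrow> (\<exists>x \<in> {1..m} \<rightarrow> carrier R. indexed_value P x = c)"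

definition binary_cubic_form :: "'a \<Rightarrow> 'a \<Rightarrow> (nat multiset \<Rightarrow> 'a)"
  where "binary_cubic_form a1 a2 =
    (indexed_const a1 \<Otimes> 1 \<Otimes> 1 \<Otimes> 1) \<Oplus> (indexed_const a2 \<Otimes> 2 \<Otimes> 2 \<Otimes> 2)"

end

lemma (in cring) indexed_value_binary_cubic_form:
  assumes "a1 \<in> carrier R" "a2 \<in> carrier R" "x 1 \<in> carrier R" "x 2 \<in> carrier R"
  shows "indexed_value (binary_cubic_form a1 a2) x =
    a1 \<otimes> x 1 [^] (3::nat) \<oplus> a2 \<otimes> x 2 [^] (3::nat)"
proof -
  let ?P = "binary_cubic_form a1 a2"
  let ?m1 = "{#1, 1, 1#} :: nat multiset" and ?m2 = "{#2, 2, 2#} :: nat multiset"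
  let ?t = "\<lambda>m. ?P m \<otimes> (\<Otimes>i\<in>set_mset m. x i [^] count m i)"
  have eqs: "m = {#i, i, i#}" if "i \<in># m" "i \<in># m - {#i#}" "i \<in># m - {#i#} - {#i#}"
    "m - {#i#} - {#i#} - {#i#} = {#}" for m and i :: nat
    by (metis add_mset_add_single insert_DiffM that)
  have P: "?P m = (if m = ?m1 then a1 else if m = ?m2 then a2 else \<zero>)" for m
    using assms(1,2) eqs[of 1 m] eqs[of 2 m]
    unfolding binary_cubic_form_def indexed_padd_def indexed_pmult_def indexed_const_def
    by (auto split: if_splits)
  have ne: "?m1 \<noteq> ?m2"
    by (auto dest: arg_cong[where f = set_mset])
  have t1: "?t ?m1 = a1 \<otimes> x 1 [^] (3::nat)"
    using assms by (simp add: P numeral_3_eq_3)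
  have t2: "?t ?m2 = a2 \<otimes> x 2 [^] (3::nat)"
    using assms ne by (simp add: P numeral_3_eq_3)
  have tc: "?t \<in> {?m1, ?m2} \<rightarrow> carrier R"
    using assms t1 t2 by auto
  have tz: "\<forall>m \<in> {?m1, ?m2} - {m. ?P m \<noteq> \<zero>}. ?t m = \<zero>"
    using assms by auto
  have "{m. ?P m \<noteq> \<zero>} \<subseteq> {?m1, ?m2}"
    unfolding P by auto
  then have "indexed_value ?P x = (\<Oplus>m\<in>{?m1, ?m2}. ?t m)"
    unfolding indexed_value_def using tz tc
    by (intro add.finprod_mono_neutral_cong_left) simp_all
  also have "\<dots> = ?t ?m1 \<oplus> ?t ?m2"
    using ne tc by (subst finsum_insert) auto
  finally show ?thesis unfolding t1 t2 .
qed


section \<open>Fields and field extensions\<close>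

text \<open>Since \<^term>\<open>group.ord\<close> is 0 for elements of infinite order, this is 0 in characteristic
  zero.\<close>

definition ring_char :: "('a, 'b) ring_scheme \<Rightarrow> nat"
  where "ring_char R = group.ord (add_monoid R) \<one>\<^bsub>R\<^esub>"

definition primitive_root_of_unity :: "('a, 'b) ring_scheme \<Rightarrow> nat \<Rightarrow> 'a \<Rightarrow> bool"
  where "primitive_root_of_unity R n w \<longleftrightarrow>
    w \<in> carrier R \<and> w [^]\<^bsub>R\<^esub> n = \<one>\<^bsub>R\<^esub> \<and> (\<forall>i. 0 < i \<and> i < n \<longrightarrow> w [^]\<^bsub>R\<^esub> i \<noteq> \<one>\<^bsub>R\<^esub>)"

definition field_extension :: "('a, 'b) ring_scheme \<Rightarrow> ('a, 'b) ring_scheme \<Rightarrow> bool"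
  where "field_extension k l \<longleftrightarrow>
    field l \<and> subfield (carrier k) l \<and> k = l\<lparr>carrier := carrier k\<rparr>"

text \<open>Automorphisms are extensional on \<^term>\<open>carrier l\<close>, as in \<^const>\<open>Bij\<close>, so that equality of
  elements of the group is equality of automorphisms.\<close>

definition galois_group ::
    "('a, 'b) ring_scheme \<Rightarrow> ('a, 'b) ring_scheme \<Rightarrow> ('a \<Rightarrow> 'a) monoid"
  where "galois_group k l = (BijGroup (carrier l))\<lparr>carrier :=
    {s \<in> Bij (carrier l). s \<in> ring_iso l l \<and> (\<forall>x\<in>carrier k. s x = x)}\<rparr>"

text \<open>A finite extension is Galois when the fixed field of its automorphism group is the base
  field.\<close>

definition finite_galois_extension ::
    "('a, 'b) ring_scheme \<Rightarrow> ('a, 'b) ring_scheme \<Rightarrow> bool"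
  where "finite_galois_extension k l \<longleftrightarrow>
    field_extension k l \<and> ring.finite_dimension l (carrier k) (carrier l) \<and>
    {x \<in> carrier l. \<forall>s\<in>carrier (galois_group k l). s x = x} = carrier k"


section \<open>Cyclic algebras, matrix algebras and their isomorphisms\<close>

text \<open>The coordinates of \<open>u\<^sub>0 + u\<^sub>1 z + \<dots> + u\<^sub>n\<^sub>-\<^sub>1 z\<^sup>n\<^sup>-\<^sup>1\<close> form a vector of dimension
  \<^term>\<open>n\<close>. From \<open>z u = \<mu>(u) z\<close> and \<open>z\<^sup>n = a\<close> one gets
  \<open>(u z\<^sup>i) (v z\<^sup>j) = u \<mu>\<^sup>i(v) a\<^sup>q z\<^sup>r\<close>, where \<open>q\<close> and \<open>r\<close> are the quotient and the remainder of
  \<open>i + j\<close> modulo \<open>n\<close>.\<close>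

definition cyclic_algebra ::
    "('a, 'b) ring_scheme \<Rightarrow> nat \<Rightarrow> ('a \<Rightarrow> 'a) \<Rightarrow> 'a \<Rightarrow> ('a, 'a vec) module"
  where "cyclic_algebra l n \<mu> a = \<lparr>
    carrier = {u \<in> carrier_vec n. \<forall>i<n. u $ i \<in> carrier l},
    monoid.mult = (\<lambda>u v. vec n (\<lambda>r. \<Oplus>\<^bsub>l\<^esub>p\<in>{(i, j). i < n \<and> j < n \<and> (i + j) mod n = r}.
      u $ fst p \<otimes>\<^bsub>l\<^esub> (\<mu> ^^ fst p) (v $ snd p) \<otimes>\<^bsub>l\<^esub> a [^]\<^bsub>l\<^esub> ((fst p + snd p) div n))),
    one = vec n (\<lambda>i. if i = 0 then \<one>\<^bsub>l\<^esub> else \<zero>\<^bsub>l\<^esub>),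
    ring.zero = vec n (\<lambda>i. \<zero>\<^bsub>l\<^esub>),
    ring.add = (\<lambda>u v. vec n (\<lambda>i. u $ i \<oplus>\<^bsub>l\<^esub> v $ i)),
    smult = (\<lambda>c u. vec n (\<lambda>i. c \<otimes>\<^bsub>l\<^esub> u $ i))\<rparr>"

lemma cyclic_algebra_mult_monomials:
  fixes l :: "('a, 'b) ring_scheme"
  assumes "cring l" "u \<in> carrier l" "v \<in> carrier l" "a \<in> carrier l" "i < n" "j < n"
    and "\<mu> \<in> ring_iso l l"
  defines "z \<equiv> \<lambda>c h. vec n (\<lambda>r. if r = h then c else \<zero>\<^bsub>l\<^esub>)"
  shows "z u i \<otimes>\<^bsub>cyclic_algebra l n \<mu> a\<^esub> z v j =
    z (u \<otimes>\<^bsub>l\<^esub> (\<mu> ^^ i) v \<otimes>\<^bsub>l\<^esub> a [^]\<^bsub>l\<^esub> ((i + j) div n)) ((i + j) mod n)"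
proof -
  interpret l: cring l by fact
  have mu: "\<mu> \<in> ring_hom l l" using assms unfolding ring_iso_def by auto
  then interpret h: ring_hom_ring l l \<mu> by (simp add: l.ring_axioms ring_hom_ringI2)
  have pc: "(\<mu> ^^ h) c \<in> carrier l" if "c \<in> carrier l" for h c
    using that by (induction h) auto
  have p0: "(\<mu> ^^ h) \<zero>\<^bsub>l\<^esub> = \<zero>\<^bsub>l\<^esub>" for h
    by (induction h) auto
  let ?w = "u \<otimes>\<^bsub>l\<^esub> (\<mu> ^^ i) v \<otimes>\<^bsub>l\<^esub> a [^]\<^bsub>l\<^esub> ((i + j) div n)"
  have w: "?w \<in> carrier l" using assms pc by auto
  have "(\<Oplus>\<^bsub>l\<^esub>p\<in>{(i, j). i < n \<and> j < n \<and> (i + j) mod n = r}.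
      z u i $ fst p \<otimes>\<^bsub>l\<^esub> (\<mu> ^^ fst p) (z v j $ snd p) \<otimes>\<^bsub>l\<^esub> a [^]\<^bsub>l\<^esub> ((fst p + snd p) div n))
      = (if r = (i + j) mod n then ?w else \<zero>\<^bsub>l\<^esub>)" (is "(\<Oplus>\<^bsub>l\<^esub>p\<in>?S. ?f p) = _") if "r < n" for r
  proof -
    have fin: "finite ?S"
      by (rule finite_subset[of _ "{..<n} \<times> {..<n}"]) auto
    have "(\<Oplus>\<^bsub>l\<^esub>p\<in>?S. ?f p) = (\<Oplus>\<^bsub>l\<^esub>p\<in>?S. if p = (i, j) then ?w else \<zero>\<^bsub>l\<^esub>)"
    proof (intro l.add.finprod_cong')
      fix p assume "p \<in> ?S"
      then show "?f p = (if p = (i, j) then ?w else \<zero>\<^bsub>l\<^esub>)"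
        using assms(2-4) pc p0 by (cases "fst p = i"; cases "snd p = j") (auto simp: z_def)
    qed (use w in auto)
    also have "\<dots> = (if r = (i + j) mod n then ?w else \<zero>\<^bsub>l\<^esub>)"
    proof (cases "(i, j) \<in> ?S")
      case True
      then show ?thesis
        using l.add.finprod_singleton_swap[OF True fin, of "\<lambda>_. ?w"] w by auto
    next
      case False
      then have "(\<Oplus>\<^bsub>l\<^esub>p\<in>?S. if p = (i, j) then ?w else \<zero>\<^bsub>l\<^esub>) = (\<Oplus>\<^bsub>l\<^esub>p\<in>?S. \<zero>\<^bsub>l\<^esub>)"
        by (intro l.add.finprod_cong') auto
      with False assms(5,6) show ?thesis by auto
    qed
    finally show ?thesis .
  qed
  then show ?thesis
    unfolding cyclic_algebra_def by (auto simp: z_def)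
qed

text \<open>The library's \<^const>\<open>ring_mat\<close> has coefficients in a type class; here they are in the
  carrier of a ring record.\<close>

definition matrix_algebra :: "('a, 'b) ring_scheme \<Rightarrow> nat \<Rightarrow> ('a, 'a mat) module"
  where "matrix_algebra R n = \<lparr>
    carrier = {A \<in> carrier_mat n n. \<forall>i<n. \<forall>j<n. A $$ (i, j) \<in> carrier R},
    monoid.mult = (\<lambda>A B. mat n n (\<lambda>(i, j). \<Oplus>\<^bsub>R\<^esub>h\<in>{..<n}. A $$ (i, h) \<otimes>\<^bsub>R\<^esub> B $$ (h, j))),
    one = mat n n (\<lambda>(i, j). if i = j then \<one>\<^bsub>R\<^esub> else \<zero>\<^bsub>R\<^esub>),
    ring.zero = mat n n (\<lambda>(i, j). \<zero>\<^bsub>R\<^esub>),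
    ring.add = (\<lambda>A B. mat n n (\<lambda>(i, j). A $$ (i, j) \<oplus>\<^bsub>R\<^esub> B $$ (i, j))),
    smult = (\<lambda>c A. mat n n (\<lambda>(i, j). c \<otimes>\<^bsub>R\<^esub> A $$ (i, j)))\<rparr>"

definition algebra_isomorphic ::
    "('a, 'r) ring_scheme \<Rightarrow> ('a, 'b, 'm) module_scheme \<Rightarrow> ('a, 'c, 'n) module_scheme \<Rightarrow> bool"
  where "algebra_isomorphic R A B \<longleftrightarrow>
    (\<exists>h \<in> ring_iso A B. \<forall>c\<in>carrier R. \<forall>x\<in>carrier A. h (c \<odot>\<^bsub>A\<^esub> x) = c \<odot>\<^bsub>B\<^esub> h x)"

end

theory Submission
  imports Defs
begin

text \<open>In each of the four cases \<open>a x\<^sup>3 = P\<^sup>3 - Q\<^sup>3\<close>, where \<open>P\<close> and \<open>Q\<close> are multiples in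
  \<open>k\<close> of powers of \<open>\<alpha>\<close> with different eigenvalues under \<open>\<mu>\<close>, so the right-hand side is the norm of
  \<open>P - Q\<close>. As \<open>P \<noteq> Q\<close>, the norm and hence \<open>x\<close> are nonzero, and \<open>a\<close> is the norm of
  \<open>c = (P - Q) / x\<close>.

  Then \<open>v \<mapsto> c \<mu>(v)\<close> satisfies the relations of the standard generator of the cyclic algebra, which
  therefore acts \<open>k\<close>-linearly on \<open>l\<close>. On the basis \<open>1, \<alpha>, \<alpha>\<^sup>2\<close> of eigenvectors of \<open>\<mu>\<close>, the element
  with coordinates \<open>u\<^sub>0, u\<^sub>1, u\<^sub>2\<close> acts, up to nonzero factors, by the discrete Fourier transform of
  the \<open>u\<^sub>i\<close>; its invertibility makes the action an isomorphism onto the matrix algebra. The same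
  transform gives the coordinates of an element of \<open>l\<close> in that basis.\<close>

section \<open>Cube roots of unity and the Fourier transform of order three\<close>

lemma (in domain) cube_root_sum:
  assumes "w \<in> carrier R" "w [^] (3::nat) = \<one>" "w \<noteq> \<one>"
  shows "\<one> \<oplus> w \<oplus> w \<otimes> w = \<zero>"
proof -
  have "(w \<ominus> \<one>) \<otimes> (\<one> \<oplus> w \<oplus> w \<otimes> w) = w [^] (3::nat) \<ominus> \<one>"
    using assms(1) unfolding numeral_3_eq_3 nat_pow_Suc nat_pow_0 by algebra
  also have "\<dots> = \<zero>"
    using assms(1,2) by (simp add: r_right_minus_eq)
  finally show ?thesis
    using assms(1,3) by (simp add: integral_iff r_right_minus_eq)
qed

lemma (in cring) cube_root_mult:
  assumes "w \<in> carrier R" "\<one> \<oplus> w \<oplus> w \<otimes> w = \<zero>"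
  shows "w \<otimes> (w \<otimes> w) = \<one>"
proof -
  have "w \<otimes> (w \<otimes> w) = \<one> \<oplus> (w \<ominus> \<one>) \<otimes> (\<one> \<oplus> w \<oplus> w \<otimes> w)"
    using assms(1) by algebra
  with assms show ?thesis by simp
qed

text \<open>Expanding the product, each mixed term carries the factor 1 + d + d^2 = 0, and N^3 has
  coefficient d^3 = 1. With N = -Q and d the quotient of two eigenvalues, the product becomes the
  norm of P - Q up to a scalar.\<close>

lemma (in cring) cube_sum_factor:
  assumes "P \<in> carrier R" "N \<in> carrier R" "d \<in> carrier R" "\<one> \<oplus> d \<oplus> d \<otimes> d = \<zero>"
  shows "(P \<oplus> N) \<otimes> (P \<oplus> d \<otimes> N) \<otimes> (P \<oplus> d \<otimes> d \<otimes> N) = P \<otimes> P \<otimes> P \<oplus> N \<otimes> N \<otimes> N"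
proof -
  have "(P \<oplus> N) \<otimes> (P \<oplus> d \<otimes> N) \<otimes> (P \<oplus> d \<otimes> d \<otimes> N)
    = P \<otimes> P \<otimes> P \<oplus> (\<one> \<oplus> d \<oplus> d \<otimes> d) \<otimes> (P \<otimes> P \<otimes> N)
      \<oplus> (\<one> \<oplus> d \<oplus> d \<otimes> d) \<otimes> (d \<otimes> P \<otimes> N \<otimes> N) \<oplus> d \<otimes> (d \<otimes> d) \<otimes> (N \<otimes> N \<otimes> N)"
    using assms(1-3) by (simp add: l_distr r_distr m_ac a_ac)
  then show ?thesis
    using assms(1-3) unfolding assms(4) cube_root_mult[OF assms(3,4)] by simp
qed

text \<open>Because w + w^2 = -1 and w^3 = 1, the polynomial X^2 + X + 1 splits as (X - w)(X - w^2).
  This later places the eigenvalue of \<alpha> in the base field, which contains \<omega>.\<close>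

lemma (in domain) cube_root_of_unity_cases:
  assumes "w \<in> carrier R" "\<one> \<oplus> w \<oplus> w \<otimes> w = \<zero>" "z \<in> carrier R" "\<one> \<oplus> z \<oplus> z \<otimes> z = \<zero>"
  shows "z = w \<or> z = w \<otimes> w"
proof -
  have "(z \<ominus> w) \<otimes> (z \<ominus> w \<otimes> w) =
    (\<one> \<oplus> z \<oplus> z \<otimes> z) \<ominus> (\<one> \<oplus> w \<oplus> w \<otimes> w) \<otimes> z \<oplus> (w \<otimes> (w \<otimes> w) \<ominus> \<one>)"
    using assms(1,3) by algebra
  also have "\<dots> = \<zero>"
    unfolding assms(2,4) cube_root_mult[OF assms(1,2)] using assms by (simp add: a_minus_def r_neg)
  finally show ?thesis
    using assms(1,3) by (simp add: integral_iff)
qed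

text \<open>If 3 = 0, then 1 + w + w^2 = (w - 1)^2, so w would be 1.\<close>

lemma (in domain) three_nonzero:
  assumes "w \<in> carrier R" "\<one> \<oplus> w \<oplus> w \<otimes> w = \<zero>" "w \<noteq> \<one>"
  shows "\<one> \<oplus> \<one> \<oplus> \<one> \<noteq> \<zero>"
proof
  assume 3: "\<one> \<oplus> \<one> \<oplus> \<one> = \<zero>"
  have "(w \<ominus> \<one>) \<otimes> (w \<ominus> \<one>) = (\<one> \<oplus> w \<oplus> w \<otimes> w) \<ominus> (\<one> \<oplus> \<one> \<oplus> \<one>) \<otimes> w"
    using assms(1) by algebra
  also have "\<dots> = \<zero>"
    unfolding assms(2) 3 using assms(1) by (simp add: a_minus_def)
  finally show False
    using assms(1,3) by (simp add: integral_iff)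
qed

text \<open>The input is a function on all of \<open>nat\<close>, of which only the values at 0, 1,
  2 matter, so coordinates of a vector and iterates of \<mu> can be fed in alike. As
  \<open>w \<otimes> w\<close> is the inverse of a cube root of unity w, the same formula also gives
  the inverse transform up to the factor 3.\<close>

definition (in ring) dft3 :: "'a \<Rightarrow> (nat \<Rightarrow> 'a) \<Rightarrow> nat \<Rightarrow> 'a"
  where "dft3 w y j = y 0 \<oplus> w [^] j \<otimes> y 1 \<oplus> (w \<otimes> w) [^] j \<otimes> y 2"

lemma less_3_cases: "n < 3 \<Longrightarrow> n = 0 \<or> n = 1 \<or> n = (2::nat)"
  by auto

text \<open>Orthogonality of characters: the coefficient of \<open>y i\<close> on the left is the
  sum of the powers w^(m(i-j)) for m = 0, 1, 2, which is 3 if i = j and 1 + w + w^2 = 0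
  otherwise.\<close>

lemma (in cring) dft3_inverse:
  assumes w: "w \<in> carrier R" "\<one> \<oplus> w \<oplus> w \<otimes> w = \<zero>"
    and y: "y 0 \<in> carrier R" "y 1 \<in> carrier R" "y 2 \<in> carrier R" and "j < 3"
  shows "dft3 (w \<otimes> w) (dft3 w y) j = (\<one> \<oplus> \<one> \<oplus> \<one>) \<otimes> y j"
proof -
  define v where "v = w \<otimes> w"
  have v: "v \<in> carrier R" "w \<otimes> w = v" "w \<otimes> v = \<one>" "v \<otimes> w = \<one>" "v \<otimes> v = w"
    using cube_root_mult[OF w] w(1) unfolding v_def by (auto simp: m_assoc)
  have s: "\<one> \<oplus> w \<oplus> v = \<zero>"
    using w v_def by simp
  have L: "dft3 (w \<otimes> w) (dft3 w y) j =
    (\<one> \<oplus> v [^] j \<oplus> w [^] j) \<otimes> y 0 \<oplus> (\<one> \<oplus> v [^] j \<otimes> w \<oplus> w [^] j \<otimes> v) \<otimes> y 1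
      \<oplus> (\<one> \<oplus> v [^] j \<otimes> v \<oplus> w [^] j \<otimes> w) \<otimes> y 2"
    using w(1) v y unfolding dft3_def
    by (simp add: numeral_2_eq_2 l_distr r_distr m_ac a_ac)
  consider "j = 0" | "j = 1" | "j = 2"
    using \<open>j < 3\<close> less_3_cases by blast
  then show ?thesis
    unfolding L using w(1) v(1) y s
    by cases (simp_all add: v numeral_2_eq_2 a_ac)
qed

lemma (in cring) dft3_closed [intro, simp]:
  assumes "w \<in> carrier R" "y 0 \<in> carrier R" "y 1 \<in> carrier R" "y 2 \<in> carrier R"
  shows "dft3 w y j \<in> carrier R"
  using assms unfolding dft3_def by simp

lemma (in ring) dft3_cong:
  "(\<And>i. i < 3 \<Longrightarrow> f i = g i) \<Longrightarrow> dft3 w f j = dft3 w g j"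
  unfolding dft3_def by simp

lemma (in cring) dft3_smult:
  assumes "w \<in> carrier R" "c \<in> carrier R" "y 0 \<in> carrier R" "y 1 \<in> carrier R" "y 2 \<in> carrier R"
  shows "dft3 w (\<lambda>i. c \<otimes> y i) j = c \<otimes> dft3 w y j"
  using assms unfolding dft3_def by (simp add: r_distr m_ac)

lemma (in abelian_monoid) finsum_3:
  assumes "distinct [p, q, r]" "f p \<in> carrier G" "f q \<in> carrier G" "f r \<in> carrier G"
  shows "(\<Oplus>i\<in>{p, q, r}. f i) = f p \<oplus> f q \<oplus> f r"
  using assms by (simp add: a_assoc)

lemma (in abelian_monoid) finsum_lessThan_3:
  assumes "f 0 \<in> carrier G" "f 1 \<in> carrier G" "f 2 \<in> carrier G"
  shows "(\<Oplus>i\<in>{..<3::nat}. f i) = f 0 \<oplus> f 1 \<oplus> f 2"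
proof -
  have "{..<3::nat} = {0, 1, 2}" by auto
  then show ?thesis using assms finsum_3[of 0 1 2 f] by simp
qed

section \<open>Coordinates in a cubic Kummer extension\<close>

text \<open>This isolates what the computation uses of the extension: a map of order dividing 3 with
  fixed field K and an eigenvector \<alpha> whose eigenvalue z is a nontrivial cube root of unity.
  Galois theory enters only when the locale is instantiated.\<close>

locale cubic_kummer = field R for R (structure) +
  fixes K \<mu> \<alpha> z
  assumes subfield: "subfield K R"
    and mu_hom: "\<mu> \<in> ring_hom R R"
    and mu_cube: "x \<in> carrier R \<Longrightarrow> \<mu> (\<mu> (\<mu> x)) = x"
    and fixed_iff: "x \<in> carrier R \<Longrightarrow> \<mu> x = x \<longleftrightarrow> x \<in> K"
    and alpha: "\<alpha> \<in> carrier R" "\<alpha> \<noteq> \<zero>" "\<mu> \<alpha> = z \<otimes> \<alpha>"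
    and z: "z \<in> K" "\<one> \<oplus> z \<oplus> z \<otimes> z = \<zero>"
    and three_nonzero: "\<one> \<oplus> \<one> \<oplus> \<one> \<noteq> \<zero>"
begin

sublocale mu: ring_hom_ring R R \<mu>
  using mu_hom ring_axioms by (simp add: ring_hom_ringI2)

lemma in_carrier: "x \<in> K \<Longrightarrow> x \<in> carrier R"
  using subfieldE(3)[OF subfield] by auto

lemma mu_fixed [simp]: "x \<in> K \<Longrightarrow> \<mu> x = x"
  using fixed_iff in_carrier by blast

lemma z_closed [simp]: "z \<in> carrier R"
  using z in_carrier by auto

lemma z_pow: "z \<otimes> (z \<otimes> z) = \<one>" "(z \<otimes> z) \<otimes> (z \<otimes> z) = z"
  using cube_root_mult[OF _ z(2)] by (auto simp: m_assoc)

lemma z_rotate: "x \<in> carrier R \<Longrightarrow> z \<otimes> (z \<otimes> (z \<otimes> x)) = x"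
  using z_pow(1) z_closed l_one m_assoc m_closed by metis

lemma zz_sum: "\<one> \<oplus> z \<otimes> z \<oplus> (z \<otimes> z) \<otimes> (z \<otimes> z) = \<zero>"
  using z(2) unfolding z_pow by (simp add: a_ac)

definition third where "third = inv (\<one> \<oplus> \<one> \<oplus> \<one>)"

lemma third: "third \<in> carrier R" "third \<otimes> (\<one> \<oplus> \<one> \<oplus> \<one>) = \<one>" "\<mu> third = third"
proof -
  have K: "\<one> \<oplus> \<one> \<oplus> \<one> \<in> K - {\<zero>}"
    using three_nonzero subringE(3,7)[OF subfieldE(1)[OF subfield]] by auto
  with subfield_m_inv[OF subfield] have "third \<in> K" "third \<otimes> (\<one> \<oplus> \<one> \<oplus> \<one>) = \<one>"
    unfolding third_def by auto
  then show "third \<in> carrier R" "third \<otimes> (\<one> \<oplus> \<one> \<oplus> \<one>) = \<one>" "\<mu> third = third"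
    using in_carrier by auto
qed

lemma third_mult: "x \<in> carrier R \<Longrightarrow> third \<otimes> ((\<one> \<oplus> \<one> \<oplus> \<one>) \<otimes> x) = x"
  using third by (subst m_assoc[symmetric]) auto

lemma inv_alpha: "inv \<alpha> \<in> carrier R" "\<alpha> \<otimes> inv \<alpha> = \<one>" "\<mu> (inv \<alpha>) = z \<otimes> z \<otimes> inv \<alpha>"
proof -
  have u: "\<alpha> \<in> Units R" using alpha field_Units by auto
  then show i: "inv \<alpha> \<in> carrier R" "\<alpha> \<otimes> inv \<alpha> = \<one>" by auto
  \<comment> \<open>The inserted factor is 1. Regrouping it turns
    \<open>z \<otimes> \<alpha>\<close> into \<open>\<mu> \<alpha>\<close>, which then cancels
    against \<open>\<mu> (inv \<alpha>)\<close>.\<close>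
  have "\<mu> (inv \<alpha>) = (z \<otimes> z \<otimes> z \<otimes> (\<alpha> \<otimes> inv \<alpha>)) \<otimes> \<mu> (inv \<alpha>)"
    using i z_pow by (simp add: m_assoc)
  also have "\<dots> = z \<otimes> z \<otimes> inv \<alpha> \<otimes> \<mu> (\<alpha> \<otimes> inv \<alpha>)"
    using i(1) alpha by (simp add: m_ac del: i)
  finally show "\<mu> (inv \<alpha>) = z \<otimes> z \<otimes> inv \<alpha>"
    using i by simp
qed

lemma pow_alpha_inv: "\<alpha> [^] (i::nat) \<otimes> inv \<alpha> [^] i = \<one>"
  using alpha inv_alpha by (simp flip: nat_pow_distrib)

text \<open>A Lagrange resolvent: a third of the transform at z^(-1) of the conjugates of x projects
  x to the eigenspace of \<mu> for z^i, and division by \<alpha>^i leaves a scalar.\<close>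

definition coord :: "nat \<Rightarrow> 'a \<Rightarrow> 'a"
  where "coord i x = third \<otimes> dft3 (z \<otimes> z) (\<lambda>j. (\<mu> ^^ j) x) i \<otimes> inv \<alpha> [^] i"

lemma dft3_mu: "dft3 (z \<otimes> z) (\<lambda>j. (\<mu> ^^ j) x) i = x \<oplus> (z \<otimes> z) [^] i \<otimes> \<mu> x \<oplus> z [^] i \<otimes> \<mu> (\<mu> x)"
  by (simp add: dft3_def numeral_2_eq_2 z_pow)

text \<open>Applying \<mu> permutes the conjugates cyclically, which multiplies the resolvent by
  z^i, while \<alpha>^(-i) is multiplied by z^(-i). The product is fixed by \<mu>.\<close>

lemma coord_in_K:
  assumes x: "x \<in> carrier R"
  shows "coord i x \<in> K"
proof -
  let ?p = "z [^] i" and ?q = "(z \<otimes> z) [^] i"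
  have pq: "?p \<otimes> ?q = \<one>" "?q \<otimes> ?q = ?p"
    by (simp_all flip: nat_pow_distrib add: z_pow)
  have fixed: "\<mu> ?p = ?p" "\<mu> ?q = ?q"
    using z by (simp_all add: mu.hom_nat_pow)
  have "\<mu> (coord i x) = third \<otimes> (\<mu> x \<oplus> ?q \<otimes> \<mu> (\<mu> x) \<oplus> ?p \<otimes> x) \<otimes> (?q \<otimes> inv \<alpha> [^] i)"
    using x inv_alpha by (simp add: coord_def dft3_mu third fixed mu_cube mu.hom_nat_pow nat_pow_distrib)
  also have "\<dots> = third \<otimes> ((?p \<otimes> ?q) \<otimes> x \<oplus> ?q \<otimes> \<mu> x \<oplus> (?q \<otimes> ?q) \<otimes> \<mu> (\<mu> x)) \<otimes> inv \<alpha> [^] i"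
    using x inv_alpha(1) third(1) by (simp add: l_distr r_distr m_ac a_ac)
  also have "\<dots> = coord i x"
    using x unfolding pq coord_def dft3_mu by simp
  finally show ?thesis
    using x inv_alpha third by (subst fixed_iff[symmetric]) (auto simp: coord_def dft3_mu)
qed

lemma coord_closed [simp]: "x \<in> carrier R \<Longrightarrow> coord i x \<in> carrier R"
  using coord_in_K in_carrier by blast

lemma coord_add:
  assumes "x \<in> carrier R" "y \<in> carrier R"
  shows "coord i (x \<oplus> y) = coord i x \<oplus> coord i y"
  using assms inv_alpha third unfolding coord_def dft3_mu
  by (simp add: l_distr r_distr m_ac a_ac)

lemma coord_smult:
  assumes "x \<in> carrier R" "c \<in> K"
  shows "coord i (c \<otimes> x) = c \<otimes> coord i x"
  using assms in_carrier[OF assms(2)] inv_alpha third unfolding coord_def dft3_mu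
  by (simp add: l_distr r_distr m_ac a_ac)

lemma coord_expansion:
  assumes "x \<in> carrier R"
  shows "coord 0 x \<oplus> coord 1 x \<otimes> \<alpha> \<oplus> coord 2 x \<otimes> \<alpha> [^] (2::nat) = x"
proof -
  define e where "e = dft3 (z \<otimes> z) (\<lambda>j. (\<mu> ^^ j) x)"
  have cl: "e i \<in> carrier R" for i
    using assms by (simp add: e_def dft3_mu)
  have c: "coord i x \<otimes> \<alpha> [^] i = third \<otimes> e i" for i
  proof -
    have "coord i x \<otimes> \<alpha> [^] i = third \<otimes> e i \<otimes> (\<alpha> [^] i \<otimes> inv \<alpha> [^] i)"
      using cl alpha inv_alpha(1) third unfolding coord_def e_def[symmetric] by (simp add: m_ac)
    then show ?thesis using cl third by (simp add: pow_alpha_inv)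
  qed
  \<comment> \<open>The plain sum of the \<open>e i\<close> is any transform of \<open>e\<close> at
    index 0. The parameter is chosen as the square of \<open>z \<otimes> z\<close> so that
    \<open>dft3_inverse\<close> applies and returns the conjugate of index 0, which is x.\<close>
  have "coord 0 x \<otimes> \<alpha> [^] (0::nat) \<oplus> coord 1 x \<otimes> \<alpha> [^] (1::nat) \<oplus> coord 2 x \<otimes> \<alpha> [^] (2::nat)
    = third \<otimes> dft3 ((z \<otimes> z) \<otimes> (z \<otimes> z)) e 0"
    unfolding c using cl third by (simp add: dft3_def r_distr)
  also have "\<dots> = x"
    unfolding e_def using assms zz_sum by (subst dft3_inverse) (auto simp: third_mult numeral_2_eq_2)
  finally show ?thesis
    using assms alpha by simp
qed

lemma coord_inject:
  assumes x: "x \<in> carrier R" and y: "y \<in> carrier R"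
    and eq: "\<And>i. i < 3 \<Longrightarrow> coord i x = coord i y"
  shows "x = y"
proof -
  have "coord 0 x = coord 0 y" "coord 1 x = coord 1 y" "coord 2 x = coord 2 y"
    by (simp_all add: eq)
  then show ?thesis
    using coord_expansion[OF x] coord_expansion[OF y] by argo
qed

text \<open>Since \<mu>^j multiplies \<alpha>^i by z^(ij), the conjugates of the sum are the
  transform at z of the terms \<open>k i \<otimes> \<alpha> [^] i\<close>, and the resolvent inverts
  it. With \<open>coord_expansion\<close> this makes 1, \<alpha>, \<alpha>^2 a basis over K.\<close>

lemma coord_unique:
  assumes k: "k 0 \<in> K" "k 1 \<in> K" "k 2 \<in> K" and "i < 3"
  shows "coord i (k 0 \<oplus> k 1 \<otimes> \<alpha> \<oplus> k 2 \<otimes> \<alpha> [^] (2::nat)) = k i"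
proof -
  let ?y = "\<lambda>j. k j \<otimes> \<alpha> [^] j" and ?x = "k 0 \<oplus> k 1 \<otimes> \<alpha> \<oplus> k 2 \<otimes> \<alpha> [^] (2::nat)"
  have kc: "k 0 \<in> carrier R" "k 1 \<in> carrier R" "k 2 \<in> carrier R"
    using k in_carrier by auto
  then have kc': "k (Suc 0) \<in> carrier R" "\<mu> (k (Suc 0)) = k (Suc 0)" "k i \<in> carrier R"
    using k less_3_cases[OF \<open>i < 3\<close>] by auto
  have e: "(\<mu> ^^ j) ?x = dft3 z ?y j" if "j < 3" for j
    using less_3_cases[OF that] k kc kc' alpha
    by (elim disjE) (simp_all add: dft3_def numeral_2_eq_2 z_pow z_rotate z m_ac)
  have "dft3 (z \<otimes> z) (\<lambda>j. (\<mu> ^^ j) ?x) i = dft3 (z \<otimes> z) (dft3 z ?y) i"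
    using e by (intro dft3_cong)
  also have "\<dots> = (\<one> \<oplus> \<one> \<oplus> \<one>) \<otimes> ?y i"
    using kc alpha z \<open>i < 3\<close> by (intro dft3_inverse) auto
  finally have "coord i ?x = k i \<otimes> \<alpha> [^] i \<otimes> inv \<alpha> [^] i"
    using kc' alpha unfolding coord_def by (simp add: third_mult)
  then show ?thesis
    using kc' alpha inv_alpha(1) by (simp add: m_assoc pow_alpha_inv)
qed

section \<open>The action of the cyclic algebra\<close>

text \<open>The generator of the cyclic algebra acts as x \<mapsto> c \<mu>(x); the last term
  contains the square of this operator.\<close>

definition twist :: "'a \<Rightarrow> (nat \<Rightarrow> 'a) \<Rightarrow> 'a \<Rightarrow> 'a"
  where "twist c u x = u 0 \<otimes> x \<oplus> u 1 \<otimes> (c \<otimes> \<mu> x) \<oplus> u 2 \<otimes> (c \<otimes> \<mu> c \<otimes> \<mu> (\<mu> x))"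

abbreviation "family u \<equiv> u 0 \<in> carrier R \<and> u 1 \<in> carrier R \<and> u 2 \<in> carrier R"

lemma twist_closed [simp]:
  "\<lbrakk>c \<in> carrier R; family u; x \<in> carrier R\<rbrakk> \<Longrightarrow> twist c u x \<in> carrier R"
  unfolding twist_def by simp

lemma twist_add_right:
  assumes "c \<in> carrier R" "family u" "x \<in> carrier R" "y \<in> carrier R"
  shows "twist c u (x \<oplus> y) = twist c u x \<oplus> twist c u y"
  using assms unfolding twist_def by (simp add: l_distr r_distr m_ac a_ac)

lemma twist_smult_right:
  assumes "c \<in> carrier R" "family u" "x \<in> carrier R" "k \<in> K"
  shows "twist c u (k \<otimes> x) = k \<otimes> twist c u x"
  using assms in_carrier[OF assms(4)] unfolding twist_def by (simp add: l_distr r_distr m_ac a_ac)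

lemma twist_add_left:
  assumes "c \<in> carrier R" "family u" "family v" "x \<in> carrier R"
  shows "twist c (\<lambda>i. u i \<oplus> v i) x = twist c u x \<oplus> twist c v x"
  using assms unfolding twist_def by (simp add: l_distr r_distr m_ac a_ac)

lemma twist_smult_left:
  assumes "c \<in> carrier R" "family u" "x \<in> carrier R" "k \<in> carrier R"
  shows "twist c (\<lambda>i. k \<otimes> u i) x = k \<otimes> twist c u x"
  using assms unfolding twist_def by (simp add: l_distr r_distr m_ac a_ac)

text \<open>The cube of x \<mapsto> c \<mu>(x) is multiplication by the norm of c, because \<mu>^3
  is the identity. So products whose exponent reaches 3 or 4 pick up one factor a, and the
  \<open>w i\<close> are the coordinates of the product in the cyclic algebra.\<close>

lemma twist_twist:
  assumes "c \<in> carrier R" "family u" "family v" "x \<in> carrier R"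
    and a: "a = c \<otimes> \<mu> c \<otimes> \<mu> (\<mu> c)"
    and w: "w 0 = u 0 \<otimes> v 0 \<oplus> u 1 \<otimes> \<mu> (v 2) \<otimes> a \<oplus> u 2 \<otimes> \<mu> (\<mu> (v 1)) \<otimes> a"
      "w 1 = u 0 \<otimes> v 1 \<oplus> u 1 \<otimes> \<mu> (v 0) \<oplus> u 2 \<otimes> \<mu> (\<mu> (v 2)) \<otimes> a"
      "w 2 = u 0 \<otimes> v 2 \<oplus> u 1 \<otimes> \<mu> (v 1) \<oplus> u 2 \<otimes> \<mu> (\<mu> (v 0))"
  shows "twist c u (twist c v x) = twist c w x"
  using assms(1-4) unfolding twist_def w a
  by (simp add: l_distr r_distr m_ac a_ac mu_cube)

text \<open>The scalar by which the i-th power of x \<mapsto> c \<mu>(x) differs from \<mu>^i, for i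
  < 3.\<close>

definition cocycle :: "'a \<Rightarrow> nat \<Rightarrow> 'a"
  where "cocycle c i = (if i = 0 then \<one> else if i = 1 then c else c \<otimes> \<mu> c)"

lemma cocycle_unit:
  assumes "c \<in> carrier R" "c \<noteq> \<zero>"
  shows "cocycle c i \<in> carrier R" "cocycle c i \<noteq> \<zero>"
proof -
  have "\<mu> c \<noteq> \<zero>"
    using assms mu_cube[of c] by auto
  then show "cocycle c i \<in> carrier R" "cocycle c i \<noteq> \<zero>"
    using assms by (auto simp: cocycle_def integral_iff)
qed

text \<open>Each \<alpha>^j is an eigenvector of \<mu>^i with eigenvalue z^(ij), so the action on it
  is multiplication by one value of a Fourier transform. Injectivity and surjectivity of the action
  thereby reduce to inverting that transform.\<close>

lemma twist_pow_alpha: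
  assumes "c \<in> carrier R" "family u"
  shows "twist c u (\<alpha> [^] (j::nat)) = dft3 z (\<lambda>i. u i \<otimes> cocycle c i) j \<otimes> \<alpha> [^] j"
  using assms alpha z
  by (simp add: twist_def dft3_def cocycle_def mu.hom_nat_pow nat_pow_distrib l_distr r_distr m_ac)

lemma family_cyclic_algebra:
  "u \<in> carrier (cyclic_algebra R 3 \<mu> a) \<Longrightarrow> family (($) u)"
  by (simp add: cyclic_algebra_def)

lemma twist_mult:
  assumes "c \<in> carrier R" "x \<in> carrier R" and a: "a = c \<otimes> \<mu> c \<otimes> \<mu> (\<mu> c)"
    and uv: "u \<in> carrier (cyclic_algebra R 3 \<mu> a)" "v \<in> carrier (cyclic_algebra R 3 \<mu> a)"
  shows "twist c (($) (u \<otimes>\<^bsub>cyclic_algebra R 3 \<mu> a\<^esub> v)) x = twist c (($) u) (twist c (($) v) x)"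
proof -
  \<comment> \<open>The index pairs of the three coordinates of a product. The pairs (1, 2), (2, 1)
    and (2, 2) have quotient 1 and contribute the factor a.\<close>
  have S: "{(i, j). i < 3 \<and> j < 3 \<and> (i + j) mod 3 = 0} = {(0, 0), (1, 2), (2, 1::nat)}"
    "{(i, j). i < 3 \<and> j < 3 \<and> (i + j) mod 3 = 1} = {(0, 1), (1, 0), (2, 2::nat)}"
    "{(i, j). i < 3 \<and> j < 3 \<and> (i + j) mod 3 = 2} = {(0, 2), (1, 1), (2, 0::nat)}"
    by (auto simp del: One_nat_def simp flip: numeral_2_eq_2 dest!: less_3_cases)
  have ac: "a \<in> carrier R" using assms by simp
  have mu_pow: "(\<mu> ^^ 1) y = \<mu> y" "(\<mu> ^^ 2) y = \<mu> (\<mu> y)" for y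
    by (simp_all add: numeral_2_eq_2)
  note fam = uv[THEN family_cyclic_algebra]
  show ?thesis
    using assms(1,2) fam a ac
    by (intro twist_twist[symmetric])
      (simp_all add: cyclic_algebra_def S mu_pow finsum_3 del: finsum_insert del: One_nat_def)
qed

text \<open>By K-linearity the action is determined on the basis. In this form the right-hand side
  is a row of the matrix of u times the coordinate column of x.\<close>

lemma coord_twist:
  assumes "c \<in> carrier R" "family u" "x \<in> carrier R"
  shows "coord i (twist c u x) = coord i (twist c u (\<alpha> [^] (0::nat))) \<otimes> coord 0 x
    \<oplus> coord i (twist c u (\<alpha> [^] (1::nat))) \<otimes> coord 1 x
    \<oplus> coord i (twist c u (\<alpha> [^] (2::nat))) \<otimes> coord 2 x"
proof -
  have "twist c u x = twist c u (coord 0 x \<otimes> \<alpha> [^] (0::nat) \<oplus> coord 1 x \<otimes> \<alpha> [^] (1::nat)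
    \<oplus> coord 2 x \<otimes> \<alpha> [^] (2::nat))"
    using coord_expansion[OF assms(3)] assms alpha by simp
  also have "\<dots> = coord 0 x \<otimes> twist c u (\<alpha> [^] (0::nat)) \<oplus> coord 1 x \<otimes> twist c u (\<alpha> [^] (1::nat))
    \<oplus> coord 2 x \<otimes> twist c u (\<alpha> [^] (2::nat))"
    using assms alpha twist_smult_right[of c u \<one> "coord 0 x"]
    by (simp add: twist_add_right twist_smult_right coord_in_K)
  finally have "coord i (twist c u x) = coord 0 x \<otimes> coord i (twist c u (\<alpha> [^] (0::nat)))
    \<oplus> coord 1 x \<otimes> coord i (twist c u (\<alpha> [^] (1::nat)))
    \<oplus> coord 2 x \<otimes> coord i (twist c u (\<alpha> [^] (2::nat)))"
    using assms alpha by (simp add: coord_add coord_smult coord_in_K)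
  then show ?thesis
    using assms alpha by (simp add: m_comm)
qed

text \<open>Cancelling \<alpha>^j leaves equal transforms, and inverting them leaves equal products
  with the nonzero factors 3 and \<open>cocycle c i\<close>.\<close>

lemma twist_inject:
  assumes c: "c \<in> carrier R" "c \<noteq> \<zero>" and u: "family u" and v: "family v" and i: "i < 3"
    and eq: "\<And>j::nat. j < 3 \<Longrightarrow> twist c u (\<alpha> [^] j) = twist c v (\<alpha> [^] j)"
  shows "u i = v i"
proof -
  let ?y = "\<lambda>u i. u i \<otimes> cocycle c i"
  have ucl: "u i \<in> carrier R" "v i \<in> carrier R"
    using u v less_3_cases[OF i] by auto
  note cc = cocycle_unit[OF c]
  have "dft3 z (?y u) j = dft3 z (?y v) j" if "j < 3" for j
  proof -
    have "dft3 z (?y u) j \<otimes> \<alpha> [^] j \<otimes> inv \<alpha> [^] j = dft3 z (?y v) j \<otimes> \<alpha> [^] j \<otimes> inv \<alpha> [^] j"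
      using eq[OF that] c u v by (simp add: twist_pow_alpha)
    then show ?thesis
      using u v cc alpha inv_alpha(1) by (simp add: m_assoc pow_alpha_inv)
  qed
  then have "dft3 (z \<otimes> z) (dft3 z (?y u)) i = dft3 (z \<otimes> z) (dft3 z (?y v)) i"
    by (rule dft3_cong)
  then have "(\<one> \<oplus> \<one> \<oplus> \<one>) \<otimes> ?y u i = (\<one> \<oplus> \<one> \<oplus> \<one>) \<otimes> ?y v i"
    using u v cc z i by (simp add: dft3_inverse)
  then have "?y u i = ?y v i"
    using third_mult ucl cc by (metis m_closed)
  then show ?thesis
    using ucl cc by (simp add: m_rcancel)
qed

lemma twist_surject:
  assumes c: "c \<in> carrier R" "c \<noteq> \<zero>" and f: "\<And>j::nat. j < 3 \<Longrightarrow> f j \<in> carrier R"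
  obtains u where "\<And>i. u i \<in> carrier R" "\<And>j::nat. j < 3 \<Longrightarrow> twist c u (\<alpha> [^] j) = f j"
proof -
  \<comment> \<open>\<open>twist_pow_alpha\<close> is solved backwards: \<open>?w\<close> is the
    transform that is needed, \<open>y\<close> its inverse transform, and \<open>u\<close> is
    \<open>y\<close> with the cocycle divided out.\<close>
  let ?w = "\<lambda>j::nat. f j \<otimes> inv \<alpha> [^] j"
  define y where "y = (\<lambda>i. third \<otimes> dft3 (z \<otimes> z) ?w i)"
  define u where "u = (\<lambda>i. y i \<otimes> inv (cocycle c i))"
  note cc = cocycle_unit[OF c]
  have inv: "inv (cocycle c i) \<in> carrier R" "inv (cocycle c i) \<otimes> cocycle c i = \<one>" for i
    using cc field_Units by auto
  have w: "?w 0 \<in> carrier R" "?w 1 \<in> carrier R" "?w 2 \<in> carrier R"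
    using f inv_alpha(1) by auto
  have y: "y i \<in> carrier R" for i
    using w third by (simp add: y_def)
  have u: "u i \<in> carrier R" for i
    using y inv by (simp add: u_def)
  have "twist c u (\<alpha> [^] j) = f j" if "j < 3" for j
  proof -
    have "(\<lambda>i. u i \<otimes> cocycle c i) = y"
      using y inv cc by (simp add: u_def m_assoc)
    then have "twist c u (\<alpha> [^] j) = dft3 z y j \<otimes> \<alpha> [^] j"
      using c u by (simp add: twist_pow_alpha)
    also have "dft3 z y j = third \<otimes> dft3 ((z \<otimes> z) \<otimes> (z \<otimes> z)) (dft3 (z \<otimes> z) ?w) j"
      unfolding y_def z_pow using w third by (simp add: dft3_smult)
    also have "\<dots> = ?w j"
      using w f[OF that] that inv_alpha(1) zz_sum by (subst dft3_inverse) (auto simp: third_mult)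
    also have "?w j \<otimes> \<alpha> [^] j = f j \<otimes> (\<alpha> [^] j \<otimes> inv \<alpha> [^] j)"
      using f[OF that] alpha inv_alpha(1) by (simp add: m_ac)
    finally show ?thesis
      using f[OF that] by (simp add: pow_alpha_inv)
  qed
  with u that show thesis by blast
qed

section \<open>The action as an isomorphism onto the matrix algebra\<close>

definition twist_matrix :: "'a \<Rightarrow> 'a vec \<Rightarrow> 'a mat"
  where "twist_matrix c u = mat 3 3 (\<lambda>(i, j). coord i (twist c (($) u) (\<alpha> [^] j)))"

text \<open>The columns of a matrix over K correspond to arbitrary images in the large field of 1,
  \<alpha>, \<alpha>^2, and every triple of images comes from exactly one u. The parameter a is free
  because the carrier of the cyclic algebra does not depend on it.\<close>

lemma twist_matrix_bij:
  assumes c: "c \<in> carrier R" "c \<noteq> \<zero>"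
  shows "bij_betw (twist_matrix c) (carrier (cyclic_algebra R 3 \<mu> a))
    (carrier (matrix_algebra (R\<lparr>carrier := K\<rparr>) 3))" (is "bij_betw _ ?A ?B")
proof (rule bij_betw_imageI)
  show "inj_on (twist_matrix c) ?A"
  proof (rule inj_onI)
    fix u v assume u: "u \<in> ?A" and v: "v \<in> ?A" and eq: "twist_matrix c u = twist_matrix c v"
    note fam = u[THEN family_cyclic_algebra] v[THEN family_cyclic_algebra]
    have "twist c (($) u) (\<alpha> [^] j) = twist c (($) v) (\<alpha> [^] j)" if j: "j < 3" for j :: nat
    proof -
      have "coord i (twist c (($) u) (\<alpha> [^] j)) = coord i (twist c (($) v) (\<alpha> [^] j))" if "i < 3" for i
        using arg_cong[OF eq, of "\<lambda>M. M $$ (i, j)"] that j by (simp add: twist_matrix_def)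
      then show ?thesis
        by (rule coord_inject[rotated 2]) (use c fam alpha in simp_all)
    qed
    then have "u $ i = v $ i" if "i < 3" for i
      using twist_inject[OF c fam that] by blast
    then show "u = v"
      using u v by (intro eq_vecI) (auto simp: cyclic_algebra_def)
  qed
  show "twist_matrix c ` ?A = ?B"
  proof (intro equalityI subsetI)
    fix M assume "M \<in> twist_matrix c ` ?A"
    then show "M \<in> ?B"
      using c alpha family_cyclic_algebra
      by (auto simp: matrix_algebra_def twist_matrix_def intro!: coord_in_K twist_closed)
  next
    fix M assume M: "M \<in> ?B"
    then have MK: "M $$ (i, j) \<in> K" if "i < 3" "j < 3" for i j
      using that by (simp add: matrix_algebra_def)
    \<comment> \<open>The image prescribed for \<alpha>^j: the field element whose coordinates form
      column j of \<open>M\<close>.\<close>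
    define f where "f j = M $$ (0, j) \<oplus> M $$ (1, j) \<otimes> \<alpha> \<oplus> M $$ (2, j) \<otimes> \<alpha> [^] (2::nat)" for j
    have "f j \<in> carrier R" if "j < 3" for j
      using MK[THEN in_carrier] that alpha by (simp add: f_def)
    with twist_surject[OF c] obtain u
      where u: "\<And>i. u i \<in> carrier R" "\<And>j. j < 3 \<Longrightarrow> twist c u (\<alpha> [^] j) = f j"
      by metis
    have "twist c (($) (vec 3 u)) x = twist c u x" for x
      by (simp add: twist_def)
    then have "M = twist_matrix c (vec 3 u)"
      using M MK u(2) coord_unique[of "\<lambda>i. M $$ (i, j)" for j]
      by (intro eq_matI) (auto simp: twist_matrix_def f_def matrix_algebra_def)
    moreover have "vec 3 u \<in> ?A"
      using u by (simp add: cyclic_algebra_def)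
    ultimately show "M \<in> twist_matrix c ` ?A" by blast
  qed
qed

lemma twist_matrix_mult:
  assumes c: "c \<in> carrier R" and a: "a = c \<otimes> \<mu> c \<otimes> \<mu> (\<mu> c)"
    and u: "u \<in> carrier (cyclic_algebra R 3 \<mu> a)" and v: "v \<in> carrier (cyclic_algebra R 3 \<mu> a)"
  shows "twist_matrix c (u \<otimes>\<^bsub>cyclic_algebra R 3 \<mu> a\<^esub> v)
    = twist_matrix c u \<otimes>\<^bsub>matrix_algebra (R\<lparr>carrier := K\<rparr>) 3\<^esub> twist_matrix c v"
proof -
  \<comment> \<open>Sums in the matrix algebra are taken in the base field, so they are expanded
    there, with all summands shown to lie in K.\<close>
  interpret k: field "R\<lparr>carrier := K\<rparr>"
    using subfield_iff(2)[OF subfield] .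
  note fam = u[THEN family_cyclic_algebra] v[THEN family_cyclic_algebra]
  note K_mult = subringE(6)[OF subfieldE(1)[OF subfield]]
  show ?thesis
  proof (rule eq_matI)
    fix i j assume "i < dim_row (twist_matrix c u \<otimes>\<^bsub>matrix_algebra (R\<lparr>carrier := K\<rparr>) 3\<^esub> twist_matrix c v)"
      "j < dim_col (twist_matrix c u \<otimes>\<^bsub>matrix_algebra (R\<lparr>carrier := K\<rparr>) 3\<^esub> twist_matrix c v)"
    then have ij: "i < 3" "j < 3"
      by (simp_all add: matrix_algebra_def)
    let ?t = "\<lambda>w (j :: nat). twist c (($) w) (\<alpha> [^] j)"
    have K: "coord i (?t w j) \<in> K" if "w \<in> {u, v}" for w i and j :: nat
      using that fam c alpha by (auto intro!: coord_in_K twist_closed)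
    have "twist_matrix c (u \<otimes>\<^bsub>cyclic_algebra R 3 \<mu> a\<^esub> v) $$ (i, j) = coord i (twist c (($) u) (?t v j))"
      using ij twist_mult[OF c _ a u v] alpha by (simp add: twist_matrix_def)
    also have "\<dots> = coord i (?t u 0) \<otimes> coord 0 (?t v j) \<oplus> coord i (?t u 1) \<otimes> coord 1 (?t v j)
      \<oplus> coord i (?t u 2) \<otimes> coord 2 (?t v j)"
      using c fam alpha by (intro coord_twist) simp_all
    also have "\<dots> = (twist_matrix c u \<otimes>\<^bsub>matrix_algebra (R\<lparr>carrier := K\<rparr>) 3\<^esub> twist_matrix c v) $$ (i, j)"
      using ij K K[of _ _ 0, simplified] K_mult unfolding matrix_algebra_def twist_matrix_def
      by (simp add: k.finsum_lessThan_3 del: One_nat_def)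
    finally show "twist_matrix c (u \<otimes>\<^bsub>cyclic_algebra R 3 \<mu> a\<^esub> v) $$ (i, j) =
      (twist_matrix c u \<otimes>\<^bsub>matrix_algebra (R\<lparr>carrier := K\<rparr>) 3\<^esub> twist_matrix c v) $$ (i, j)" .
  qed (simp_all add: matrix_algebra_def twist_matrix_def)
qed

lemma twist_matrix_one:
  assumes "c \<in> carrier R"
  shows "twist_matrix c \<one>\<^bsub>cyclic_algebra R 3 \<mu> a\<^esub> = \<one>\<^bsub>matrix_algebra (R\<lparr>carrier := K\<rparr>) 3\<^esub>"
proof -
  have K: "\<one> \<in> K" "\<zero> \<in> K"
    using subringE(2,3)[OF subfieldE(1)[OF subfield]] by auto
  have "coord i (\<alpha> [^] j) = (if i = j then \<one> else \<zero>)" if "i < 3" "j < 3" for i j :: nat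
    using coord_unique[OF _ _ _ that(1), of "\<lambda>i. if i = j then \<one> else \<zero>"] K alpha less_3_cases[OF that(2)]
    by auto
  moreover have "twist c (($) \<one>\<^bsub>cyclic_algebra R 3 \<mu> a\<^esub>) x = x" if "x \<in> carrier R" for x
    using that assms by (simp add: twist_def cyclic_algebra_def)
  ultimately show ?thesis
    using alpha by (auto simp: twist_matrix_def matrix_algebra_def)
qed

lemma twist_matrix_add:
  assumes "c \<in> carrier R" "u \<in> carrier (cyclic_algebra R 3 \<mu> a)" "v \<in> carrier (cyclic_algebra R 3 \<mu> a)"
  shows "twist_matrix c (u \<oplus>\<^bsub>cyclic_algebra R 3 \<mu> a\<^esub> v)
    = twist_matrix c u \<oplus>\<^bsub>matrix_algebra (R\<lparr>carrier := K\<rparr>) 3\<^esub> twist_matrix c v"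
proof -
  note fam = assms(2,3)[THEN family_cyclic_algebra]
  have "twist c (($) (u \<oplus>\<^bsub>cyclic_algebra R 3 \<mu> a\<^esub> v)) x = twist c (\<lambda>i. u $ i \<oplus> v $ i) x" for x
    by (simp add: twist_def cyclic_algebra_def)
  then show ?thesis
    using assms(1) fam alpha
    by (auto simp: twist_matrix_def matrix_algebra_def twist_add_left coord_add)
qed

lemma twist_matrix_smult:
  assumes "c \<in> carrier R" "u \<in> carrier (cyclic_algebra R 3 \<mu> a)" "r \<in> K"
  shows "twist_matrix c (r \<odot>\<^bsub>cyclic_algebra R 3 \<mu> a\<^esub> u)
    = r \<odot>\<^bsub>matrix_algebra (R\<lparr>carrier := K\<rparr>) 3\<^esub> twist_matrix c u"
proof -
  note fam = assms(2)[THEN family_cyclic_algebra]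
  have "twist c (($) (r \<odot>\<^bsub>cyclic_algebra R 3 \<mu> a\<^esub> u)) x = twist c (\<lambda>i. r \<otimes> u $ i) x" for x
    by (simp add: twist_def cyclic_algebra_def)
  then show ?thesis
    using assms(1,3) in_carrier[OF assms(3)] fam alpha
    by (auto simp: twist_matrix_def matrix_algebra_def twist_smult_left coord_smult)
qed

lemma split_if_norm:
  assumes c: "c \<in> carrier R" "c \<noteq> \<zero>" and a: "a = c \<otimes> \<mu> c \<otimes> \<mu> (\<mu> c)"
  shows "algebra_isomorphic (R\<lparr>carrier := K\<rparr>) (cyclic_algebra R 3 \<mu> a)
    (matrix_algebra (R\<lparr>carrier := K\<rparr>) 3)"
proof -
  have "twist_matrix c \<in> ring_hom (cyclic_algebra R 3 \<mu> a) (matrix_algebra (R\<lparr>carrier := K\<rparr>) 3)"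
  proof (rule ring_hom_memI)
    fix u v assume u: "u \<in> carrier (cyclic_algebra R 3 \<mu> a)"
      and v: "v \<in> carrier (cyclic_algebra R 3 \<mu> a)"
    show "twist_matrix c u \<in> carrier (matrix_algebra (R\<lparr>carrier := K\<rparr>) 3)"
      using bij_betwE[OF twist_matrix_bij[OF c]] u by blast
    show "twist_matrix c (u \<otimes>\<^bsub>cyclic_algebra R 3 \<mu> a\<^esub> v)
      = twist_matrix c u \<otimes>\<^bsub>matrix_algebra (R\<lparr>carrier := K\<rparr>) 3\<^esub> twist_matrix c v"
      using twist_matrix_mult[OF c(1) a u v] .
    show "twist_matrix c (u \<oplus>\<^bsub>cyclic_algebra R 3 \<mu> a\<^esub> v)
      = twist_matrix c u \<oplus>\<^bsub>matrix_algebra (R\<lparr>carrier := K\<rparr>) 3\<^esub> twist_matrix c v"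
      using twist_matrix_add[OF c(1) u v] .
  qed (rule twist_matrix_one[OF c(1)])
  then have "twist_matrix c \<in> ring_iso (cyclic_algebra R 3 \<mu> a) (matrix_algebra (R\<lparr>carrier := K\<rparr>) 3)"
    unfolding ring_iso_def using twist_matrix_bij[OF c] by blast
  moreover have "\<forall>r\<in>carrier (R\<lparr>carrier := K\<rparr>). \<forall>u\<in>carrier (cyclic_algebra R 3 \<mu> a).
    twist_matrix c (r \<odot>\<^bsub>cyclic_algebra R 3 \<mu> a\<^esub> u)
      = r \<odot>\<^bsub>matrix_algebra (R\<lparr>carrier := K\<rparr>) 3\<^esub> twist_matrix c u"
    using twist_matrix_smult[OF c(1)] by simp
  ultimately show ?thesis
    unfolding algebra_isomorphic_def by blast
qed

section \<open>Norms\<close>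

text \<open>The conjugates of P - Q are e(P - dQ) and e^2(P - d^2 Q), so its norm is P^3 - Q^3 = a
  x^3, and dividing by x in K divides the norm by x^3. Q may be zero, which covers representations
  with y = 0.\<close>

lemma norm_if_diff_of_cubes:
  assumes P: "P \<in> carrier R" "P \<noteq> \<zero>" "\<mu> P = e \<otimes> P" and Q: "Q \<in> carrier R" "\<mu> Q = e \<otimes> d \<otimes> Q"
    and e: "e \<in> K" "e \<otimes> e \<otimes> e = \<one>" and d: "d \<in> K" "\<one> \<oplus> d \<oplus> d \<otimes> d = \<zero>"
    and a: "a \<in> carrier R" "a \<noteq> \<zero>" and x: "x \<in> K" "a \<otimes> (x \<otimes> x \<otimes> x) \<oplus> Q \<otimes> Q \<otimes> Q = P \<otimes> P \<otimes> P"
  shows "\<exists>c\<in>carrier R. c \<noteq> \<zero> \<and> a = c \<otimes> \<mu> c \<otimes> \<mu> (\<mu> c)"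
proof -
  have xc: "x \<in> carrier R" and ec: "e \<in> carrier R" and dc: "d \<in> carrier R"
    using x e d in_carrier by auto
  define g where "g = P \<oplus> \<ominus> Q"
  have g: "g \<in> carrier R"
    using P Q by (simp add: g_def)
  have mu_g: "\<mu> g = e \<otimes> (P \<oplus> d \<otimes> \<ominus> Q)" "\<mu> (\<mu> g) = e \<otimes> e \<otimes> (P \<oplus> d \<otimes> d \<otimes> \<ominus> Q)"
    using P Q ec dc e(1) d(1)
    by (simp_all add: g_def r_distr m_ac r_minus)
  have "g \<otimes> \<mu> g \<otimes> \<mu> (\<mu> g) = (e \<otimes> e \<otimes> e) \<otimes>
      ((P \<oplus> \<ominus> Q) \<otimes> (P \<oplus> d \<otimes> \<ominus> Q) \<otimes> (P \<oplus> d \<otimes> d \<otimes> \<ominus> Q))"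
    unfolding mu_g(2) unfolding mu_g(1) unfolding g_def using P(1) Q(1) ec dc by (simp only: m_ac m_closed a_closed a_inv_closed)
  also have "\<dots> = P \<otimes> P \<otimes> P \<oplus> (\<ominus> Q) \<otimes> (\<ominus> Q) \<otimes> (\<ominus> Q)"
    using P(1) Q(1) dc d(2) by (simp only: e cube_sum_factor l_one a_inv_closed m_closed a_closed)
  also have "\<dots> = a \<otimes> (x \<otimes> x \<otimes> x)"
    unfolding x(2)[symmetric] using a(1) xc Q(1) by (simp add: r_minus l_minus a_assoc r_neg)
  finally have N: "g \<otimes> \<mu> g \<otimes> \<mu> (\<mu> g) = a \<otimes> (x \<otimes> x \<otimes> x)" .
  have e0: "e \<noteq> \<zero>"
    using e(2) ec by auto
  have d1: "d \<noteq> \<one>"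
    using d(2) three_nonzero by auto
  \<comment> \<open>If P = Q, this nonzero element would have both eigenvalues e and ed, forcing d =
    1.\<close>
  have g0: "g \<noteq> \<zero>"
  proof
    assume "g = \<zero>"
    then have "P = Q"
      using P Q r_right_minus_eq unfolding g_def a_minus_def by blast
    then have "e \<otimes> P = e \<otimes> (d \<otimes> P)"
      using P Q ec dc by (simp add: m_assoc)
    then have "\<one> \<otimes> P = d \<otimes> P"
      using P ec dc e0 by (simp add: m_lcancel)
    then show False
      using P dc d1 m_rcancel[of P \<one> d] by simp
  qed
  then have "\<mu> g \<noteq> \<zero>" "\<mu> (\<mu> g) \<noteq> \<zero>"
    using mu_cube[OF g] by auto
  \<comment> \<open>The norm of \<open>g\<close> is a product of nonzero conjugates and equals a
    x^3.\<close>
  with N g0 have "x \<noteq> \<zero>"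
    using g xc a by (auto simp: integral_iff)
  then have y: "inv x \<in> K" "x \<otimes> inv x = \<one>" "inv x \<in> carrier R" "inv x \<noteq> \<zero>"
    using subfield_m_inv[OF subfield] x in_carrier by auto
  have "(g \<otimes> inv x) \<otimes> \<mu> (g \<otimes> inv x) \<otimes> \<mu> (\<mu> (g \<otimes> inv x))
      = (g \<otimes> \<mu> g \<otimes> \<mu> (\<mu> g)) \<otimes> (inv x \<otimes> inv x \<otimes> inv x)"
    using g y by (simp add: m_ac)
  also have "\<dots> = a \<otimes> ((x \<otimes> inv x) \<otimes> (x \<otimes> inv x) \<otimes> (x \<otimes> inv x))"
    unfolding N using a xc y(3) by (simp only: m_ac m_closed)
  also have "\<dots> = a"
    unfolding y using a by simp
  finally show ?thesis
    using g y g0 by (intro bexI[of _ "g \<otimes> inv x"]) (simp_all only: integral_iff m_closed simp_thms)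
qed

text \<open>From \<alpha>^3 = b, the values 1, b, b^2 are the cubes of 1, \<alpha>, \<alpha>^2, and
  the second terms of the forms are the cubes of \<alpha> y and \<alpha>^2 y. In each case P and Q
  involve different powers of \<alpha>, hence have different eigenvalues.\<close>

lemma norm_if_represents:
  assumes a: "a \<in> K" "a \<noteq> \<zero>" and b: "b = \<alpha> [^] (3::nat)"
    and x: "x \<in> K" "y \<in> K"
    and repr: "a \<otimes> x [^] (3::nat) \<oplus> b \<otimes> y [^] (3::nat) \<in> {\<one>, b [^] (2::nat)} \<or>
      a \<otimes> x [^] (3::nat) \<oplus> b [^] (2::nat) \<otimes> y [^] (3::nat) \<in> {\<one>, b}"
  shows "\<exists>c\<in>carrier R. c \<noteq> \<zero> \<and> a = c \<otimes> \<mu> c \<otimes> \<mu> (\<mu> c)"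
proof -
  note cl = a(1)[THEN in_carrier] x[THEN in_carrier] alpha(1) z_closed
  have zzK: "z \<otimes> z \<in> K"
    using z subringE(6)[OF subfieldE(1)[OF subfield]] by auto
  have z3: "z \<otimes> z \<otimes> z = \<one>" "z \<otimes> z \<otimes> (z \<otimes> z) \<otimes> (z \<otimes> z) = \<one>"
    using z_pow by (simp_all add: m_assoc)
  have K1: "\<one> \<in> K"
    using subringE(3)[OF subfieldE(1)[OF subfield]] .
  have cube: "u [^] (3::nat) = u \<otimes> u \<otimes> u" and square: "u [^] (2::nat) = u \<otimes> u" if "u \<in> carrier R" for u
    using that by (simp_all add: numeral_3_eq_3 numeral_2_eq_2)
  have aa: "\<alpha> \<otimes> \<alpha> \<noteq> \<zero>"
    using alpha by (simp add: integral_iff)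
  have mu_ay: "\<mu> (\<alpha> \<otimes> y) = z \<otimes> (\<alpha> \<otimes> y)" "\<mu> (\<alpha> \<otimes> \<alpha> \<otimes> y) = z \<otimes> z \<otimes> (\<alpha> \<otimes> \<alpha> \<otimes> y)"
    "\<mu> (\<alpha> \<otimes> \<alpha>) = z \<otimes> z \<otimes> (\<alpha> \<otimes> \<alpha>)"
    using cl x alpha by (simp_all add: m_ac)
  from repr consider
      "a \<otimes> x [^] (3::nat) \<oplus> b \<otimes> y [^] (3::nat) = \<one>"
    | "a \<otimes> x [^] (3::nat) \<oplus> b \<otimes> y [^] (3::nat) = b [^] (2::nat)"
    | "a \<otimes> x [^] (3::nat) \<oplus> b [^] (2::nat) \<otimes> y [^] (3::nat) = \<one>"
    | "a \<otimes> x [^] (3::nat) \<oplus> b [^] (2::nat) \<otimes> y [^] (3::nat) = b"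
    by blast
  then show ?thesis
  proof cases
    case 1
    show ?thesis
      by (rule norm_if_diff_of_cubes[of \<one> \<one> "\<alpha> \<otimes> y" z a x])
        (use 1 cl a x z K1 mu_ay in \<open>simp_all add: b cube m_ac\<close>)
  next
    \<comment> \<open>Here P = \<alpha>^2 has eigenvalue e = z^2 and Q = \<alpha> y has eigenvalue z
      = z^2 z^2, so the quotient d is z^2.\<close>
    case 2
    show ?thesis
      by (rule norm_if_diff_of_cubes[of "\<alpha> \<otimes> \<alpha>" "z \<otimes> z" "\<alpha> \<otimes> y" "z \<otimes> z" a x])
        (use 2 cl a x zzK zz_sum z3 z_pow mu_ay aa in \<open>simp_all add: b cube square m_ac\<close>)
  next
    case 3
    show ?thesis
      by (rule norm_if_diff_of_cubes[of \<one> \<one> "\<alpha> \<otimes> \<alpha> \<otimes> y" "z \<otimes> z" a x])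
        (use 3 cl a x zzK zz_sum K1 mu_ay in \<open>simp_all add: b cube square m_ac\<close>)
  next
    case 4
    show ?thesis
      by (rule norm_if_diff_of_cubes[of \<alpha> z "\<alpha> \<otimes> \<alpha> \<otimes> y" z a x])
        (use 4 cl a x z z3 alpha mu_ay in \<open>simp_all add: b cube square m_ac\<close>)
  qed
qed

end

section \<open>The generator of the Galois group\<close>

lemma galois_group_generator_order_3:
  assumes \<phi>: "\<phi> \<in> iso (integer_mod_group 3) (galois_group k l)"
  shows "\<phi> 1 \<in> carrier (galois_group k l)" "carrier (galois_group k l) = {\<phi> 0, \<phi> 1, \<phi> 2}"
    "\<phi> 1 \<noteq> \<phi> 0"
    and "x \<in> carrier l \<Longrightarrow> \<phi> 0 x = x" "x \<in> carrier l \<Longrightarrow> \<phi> 2 x = \<phi> 1 (\<phi> 1 x)"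
    "x \<in> carrier l \<Longrightarrow> \<phi> 1 (\<phi> 1 (\<phi> 1 x)) = x"
proof -
  have Z: "carrier (integer_mod_group 3) = {0, 1, 2}"
    by (auto simp: carrier_integer_mod_group)
  have bij: "bij_betw \<phi> {0, 1, 2} (carrier (galois_group k l))"
    and hom: "\<phi> \<in> hom (integer_mod_group 3) (galois_group k l)"
    using \<phi> unfolding iso_def Z by auto
  show G: "carrier (galois_group k l) = {\<phi> 0, \<phi> 1, \<phi> 2}"
    using bij by (auto simp: bij_betw_def)
  then show "\<phi> 1 \<in> carrier (galois_group k l)" by simp
  show "\<phi> 1 \<noteq> \<phi> 0"
    using bij by (auto simp: bij_betw_def)
  have Bij: "\<phi> i \<in> Bij (carrier l)" if "i \<in> {0, 1, 2}" for i
    using bij_betwE[OF bij] that by (auto simp: galois_group_def)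
  have mult: "\<phi> ((i + j) mod 3) x = \<phi> i (\<phi> j x)"
    if "i \<in> {0, 1, 2}" "j \<in> {0, 1, 2}" "x \<in> carrier l" for i j x
    using hom_mult[OF hom, of i j] Bij[OF that(1)] Bij[OF that(2)] that
    by (simp only: Z) (simp add: galois_group_def BijGroup_def compose_def)
  \<comment> \<open>\<open>\<phi> 0\<close> is idempotent, as 0 + 0 = 0, and injective, so it fixes
    every point.\<close>
  have 0: "\<phi> 0 x = x" if x: "x \<in> carrier l" for x
  proof -
    have b: "bij_betw (\<phi> 0) (carrier l) (carrier l)"
      using Bij[of 0] by (simp add: Bij_def)
    then have "\<phi> 0 x \<in> carrier l"
      using x bij_betwE by blast
    with b x mult[of 0 0 x] show ?thesis
      by (auto simp: bij_betw_def inj_on_def)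
  qed
  show "x \<in> carrier l \<Longrightarrow> \<phi> 0 x = x" by (rule 0)
  show 2: "\<phi> 2 x = \<phi> 1 (\<phi> 1 x)" if "x \<in> carrier l"
    using mult[of 1 1 x] that by simp
  show "\<phi> 1 (\<phi> 1 (\<phi> 1 x)) = x" if "x \<in> carrier l"
    using mult[of 1 2 x] 2[OF that] 0[OF that] that by simp
qed

text \<open>As \<mu> fixes b = \<alpha>^3, the quotient \<mu>(\<alpha>) / \<alpha> is a cube root of
  unity. It is not 1 since \<alpha> generates l and \<mu> is nontrivial, and it is then \<omega> or
  \<omega>^2, so it lies in k.\<close>

lemma kummer_generator:
  fixes k l :: "('a, 'm) ring_scheme"
  assumes ext: "field_extension k l"
    and root: "primitive_root_of_unity k 3 \<omega>"
    and \<alpha>: "\<alpha> \<in> carrier l" "generate_field l (insert \<alpha> (carrier k)) = carrier l"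
      "\<alpha> [^]\<^bsub>l\<^esub> (3::nat) \<in> carrier k - {\<zero>\<^bsub>l\<^esub>}"
    and gal: "finite_galois_extension k l"
    and \<phi>: "\<phi> \<in> iso (integer_mod_group 3) (galois_group k l)"
  shows "cubic_kummer l (carrier k) (\<phi> 1) \<alpha> (\<phi> 1 \<alpha> \<otimes>\<^bsub>l\<^esub> inv\<^bsub>l\<^esub> \<alpha>)"
proof -
  have l: "field l" and sub: "subfield (carrier k) l" and kl: "k = l\<lparr>carrier := carrier k\<rparr>"
    using ext by (auto simp: field_extension_def)
  interpret l: field l by fact
  note gen = galois_group_generator_order_3[OF \<phi>]
  let ?\<mu> = "\<phi> 1" and ?z = "\<phi> 1 \<alpha> \<otimes>\<^bsub>l\<^esub> inv\<^bsub>l\<^esub> \<alpha>"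
  have "?\<mu> \<in> ring_iso l l" "\<And>x. x \<in> carrier k \<Longrightarrow> ?\<mu> x = x" and ext1: "?\<mu> \<in> extensional (carrier l)"
    using gen(1) by (auto simp: galois_group_def Bij_def)
  then have hom: "?\<mu> \<in> ring_hom l l" and fix_k: "\<And>x. x \<in> carrier k \<Longrightarrow> ?\<mu> x = x"
    by (auto simp: ring_iso_def)
  interpret mu: ring_hom_ring l l ?\<mu>
    using hom l.ring_axioms by (simp add: ring_hom_ringI2)
  have k_sub: "carrier k \<subseteq> carrier l"
    using subfieldE(3)[OF sub] .
  have fixed: "?\<mu> x = x \<longleftrightarrow> x \<in> carrier k" if "x \<in> carrier l" for x
  proof
    assume "?\<mu> x = x"
    then have "\<forall>s\<in>carrier (galois_group k l). s x = x"
      using that gen by auto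
    then show "x \<in> carrier k"
      using gal that unfolding finite_galois_extension_def by blast
  qed (rule fix_k)
  have ops: "x [^]\<^bsub>k\<^esub> n = x [^]\<^bsub>l\<^esub> n" "\<one>\<^bsub>k\<^esub> = \<one>\<^bsub>l\<^esub>" for x and n :: nat
    by (subst kl, simp add: nat_pow_def)+
  have \<omega>: "\<omega> \<in> carrier k" "\<omega> [^]\<^bsub>l\<^esub> (3::nat) = \<one>\<^bsub>l\<^esub>" "\<omega> [^]\<^bsub>l\<^esub> (1::nat) \<noteq> \<one>\<^bsub>l\<^esub>"
    using root unfolding primitive_root_of_unity_def ops by auto
  then have \<omega>l: "\<omega> \<in> carrier l" "\<omega> \<noteq> \<one>\<^bsub>l\<^esub>"
    using k_sub by auto
  note \<omega>_sum = l.cube_root_sum[OF \<omega>l(1) \<omega>(2) \<omega>l(2)]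
  have \<alpha>0: "\<alpha> \<noteq> \<zero>\<^bsub>l\<^esub>"
    using \<alpha>(3) by (auto simp: l.nat_pow_zero)
  then have inv: "inv\<^bsub>l\<^esub> \<alpha> \<in> carrier l" "inv\<^bsub>l\<^esub> \<alpha> \<otimes>\<^bsub>l\<^esub> \<alpha> = \<one>\<^bsub>l\<^esub>"
    using \<alpha>(1) l.field_Units by auto
  have \<mu>\<alpha>: "?\<mu> \<alpha> = ?z \<otimes>\<^bsub>l\<^esub> \<alpha>"
    using \<alpha>(1) inv by (simp add: l.m_assoc)
  have z: "?z \<in> carrier l"
    using \<alpha>(1) inv by simp
  have "?z [^]\<^bsub>l\<^esub> (3::nat) = ?\<mu> (\<alpha> [^]\<^bsub>l\<^esub> (3::nat)) \<otimes>\<^bsub>l\<^esub> inv\<^bsub>l\<^esub> \<alpha> [^]\<^bsub>l\<^esub> (3::nat)"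
    using \<alpha>(1) inv by (simp add: l.nat_pow_distrib mu.hom_nat_pow)
  also have "\<dots> = (inv\<^bsub>l\<^esub> \<alpha> \<otimes>\<^bsub>l\<^esub> \<alpha>) [^]\<^bsub>l\<^esub> (3::nat)"
    using \<alpha> inv(1) fix_k[of "\<alpha> [^]\<^bsub>l\<^esub> (3::nat)"] by (simp add: l.nat_pow_distrib l.m_comm)
  finally have z3: "?z [^]\<^bsub>l\<^esub> (3::nat) = \<one>\<^bsub>l\<^esub>"
    using inv by simp
  have z1: "?z \<noteq> \<one>\<^bsub>l\<^esub>"
  proof
    assume "?z = \<one>\<^bsub>l\<^esub>"
    then have "\<alpha> \<in> carrier k"
      using \<mu>\<alpha> \<alpha>(1) fixed by simp
    then have "carrier l = carrier k"
      using l.generate_field_min_subfield1[OF _ sub, of "insert \<alpha> (carrier k)"] \<alpha> k_sub by auto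
    \<comment> \<open>Both automorphisms are the identity on l = k; extensionality makes them equal
      as functions, against the injectivity of \<open>\<phi>\<close>.\<close>
    moreover have "\<phi> 0 \<in> extensional (carrier l)"
      using gen(2) by (auto simp: galois_group_def Bij_def)
    ultimately have "?\<mu> = \<phi> 0"
      using ext1 gen(4) fix_k by (intro extensionalityI[of _ "carrier l"]) auto
    with gen(3) show False ..
  qed
  note z_sum = l.cube_root_sum[OF z z3 z1]
  have "?z \<in> carrier k"
    using l.cube_root_of_unity_cases[OF \<omega>l(1) \<omega>_sum z z_sum] \<omega>(1)
      subringE(6)[OF subfieldE(1)[OF sub]] by auto
  then show ?thesis
    using l sub hom gen(6) fixed \<alpha>(1) \<alpha>0 \<mu>\<alpha> z_sum l.three_nonzero[OF \<omega>l(1) \<omega>_sum \<omega>l(2)]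
    by (intro cubic_kummer.intro cubic_kummer_axioms.intro)
qed

section \<open>From a represented value to the splitting of the algebra\<close>

theorem corollary1:
  fixes k l :: "('a, 'm) ring_scheme"
    and \<omega> \<alpha> a b :: 'a
    and \<phi> :: "int \<Rightarrow> 'a \<Rightarrow> 'a"
  assumes "field_extension k l"
    and "ring_char k \<noteq> 3"
    and "primitive_root_of_unity k 3 \<omega>"
    and "ring.dimension l 3 (carrier k) (carrier l)"
    and "\<alpha> \<in> carrier l"
    and "generate_field l (insert \<alpha> (carrier k)) = carrier l"
    and "b \<in> carrier k - {\<zero>\<^bsub>k\<^esub>}"
    and "\<alpha> [^]\<^bsub>l\<^esub> (3::nat) = b"
    and "a \<in> carrier k - {\<zero>\<^bsub>k\<^esub>}"
    and "finite_galois_extension k l"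
    and "\<phi> \<in> iso (integer_mod_group 3) (galois_group k l)"
    and "ring.represents k 2 (ring.binary_cubic_form k a b) \<one>\<^bsub>k\<^esub> \<or>
         ring.represents k 2 (ring.binary_cubic_form k a b) (b [^]\<^bsub>k\<^esub> (2::nat)) \<or>
         ring.represents k 2 (ring.binary_cubic_form k a (b [^]\<^bsub>k\<^esub> (2::nat))) \<one>\<^bsub>k\<^esub> \<or>
         ring.represents k 2 (ring.binary_cubic_form k a (b [^]\<^bsub>k\<^esub> (2::nat))) b"
  shows "algebra_isomorphic k (cyclic_algebra l 3 (\<phi> 1) a) (matrix_algebra k 3)"
proof -
  have l: "field l" and sub: "subfield (carrier k) l" and kl: "k = l\<lparr>carrier := carrier k\<rparr>"
    using assms(1) by (auto simp: field_extension_def)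
  interpret l: field l by fact
  interpret k: field k
    using l.subfield_iff(2)[OF sub] by (simp flip: kl)
  have ops: "x [^]\<^bsub>k\<^esub> n = x [^]\<^bsub>l\<^esub> n" "x \<otimes>\<^bsub>k\<^esub> y = x \<otimes>\<^bsub>l\<^esub> y" "x \<oplus>\<^bsub>k\<^esub> y = x \<oplus>\<^bsub>l\<^esub> y"
    "\<one>\<^bsub>k\<^esub> = \<one>\<^bsub>l\<^esub>" "\<zero>\<^bsub>k\<^esub> = \<zero>\<^bsub>l\<^esub>" for x y and n :: nat
    by (subst kl, simp add: nat_pow_def)+
  interpret cubic_kummer l "carrier k" "\<phi> 1" \<alpha> "\<phi> 1 \<alpha> \<otimes>\<^bsub>l\<^esub> inv\<^bsub>l\<^esub> \<alpha>"
    using assms(1,3,5,6,7,8,10,11) by (intro kummer_generator[of _ _ \<omega>]) (simp_all add: ops)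
  \<comment> \<open>Evaluation of the formal polynomial in k is replaced by an equation in the
    operations of l, where the norm argument takes place.\<close>
  have rep: "\<exists>x\<in>carrier k. \<exists>y\<in>carrier k. a \<otimes>\<^bsub>l\<^esub> x [^]\<^bsub>l\<^esub> (3::nat) \<oplus>\<^bsub>l\<^esub> e \<otimes>\<^bsub>l\<^esub> y [^]\<^bsub>l\<^esub> (3::nat) = c"
    if "ring.represents k 2 (ring.binary_cubic_form k a e) c" "e \<in> carrier k" for e c
  proof -
    obtain x where "x \<in> {1..2} \<rightarrow> carrier k" "k.indexed_value (k.binary_cubic_form a e) x = c"
      using \<open>ring.represents k 2 (ring.binary_cubic_form k a e) c\<close> by (auto simp: k.represents_def)
    moreover from this have x: "x 1 \<in> carrier k" "x 2 \<in> carrier k"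
      by auto
    ultimately have "a \<otimes>\<^bsub>l\<^esub> x 1 [^]\<^bsub>l\<^esub> (3::nat) \<oplus>\<^bsub>l\<^esub> e \<otimes>\<^bsub>l\<^esub> x 2 [^]\<^bsub>l\<^esub> (3::nat) = c"
      using assms(9) that(2) k.indexed_value_binary_cubic_form[of a e x] by (simp add: ops)
    with x show ?thesis by blast
  qed
  have b: "b \<in> carrier k" "b [^]\<^bsub>k\<^esub> (2::nat) \<in> carrier k"
    using assms(7) by auto
  obtain x y where xy: "x \<in> carrier k" "y \<in> carrier k"
    and "a \<otimes>\<^bsub>l\<^esub> x [^]\<^bsub>l\<^esub> (3::nat) \<oplus>\<^bsub>l\<^esub> b \<otimes>\<^bsub>l\<^esub> y [^]\<^bsub>l\<^esub> (3::nat) \<in> {\<one>\<^bsub>l\<^esub>, b [^]\<^bsub>l\<^esub> (2::nat)} \<or>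
      a \<otimes>\<^bsub>l\<^esub> x [^]\<^bsub>l\<^esub> (3::nat) \<oplus>\<^bsub>l\<^esub> b [^]\<^bsub>l\<^esub> (2::nat) \<otimes>\<^bsub>l\<^esub> y [^]\<^bsub>l\<^esub> (3::nat) \<in> {\<one>\<^bsub>l\<^esub>, b}"
    using assms(12) rep[OF _ b(1)] rep[OF _ b(2)] unfolding ops by blast
  then obtain c where "c \<in> carrier l" "c \<noteq> \<zero>\<^bsub>l\<^esub>" "a = c \<otimes>\<^bsub>l\<^esub> \<phi> 1 c \<otimes>\<^bsub>l\<^esub> \<phi> 1 (\<phi> 1 c)"
    using assms(8,9) norm_if_represents[of a b x y] by (auto simp: ops)
  from split_if_norm[OF this] show ?thesis
    by (simp flip: kl)
qed

end
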